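(* Let $f:\mathbb{R}^m\to\mathbb{R}$ be a $C^3$ function which is Morse. Let $x_0\in\mathbb{R}^m$ be a random initial point (i.e. $x_0$ lies outside some exceptional set of Lebesgue measure $0$), and let $\{x_n\}$ be a sequence constructed by the algorithm New Q-Newton's method Backtracking G (defined in the context) applied to $f$ with initial point $x_0$. Then either $\lim_{n\to\infty}\|x_n\|=\infty$, or $x_n$ converges to a critical point of $f$. Moreover, if $f$ has compact sublevels, then only the second alternative occurs.
   Context: Notation. $\langle\cdot,\cdot\rangle$ and $\|\cdot\|$ are the Euclidean inner product and norm on $\mathbb{R}^m$; $\nabla f$ and $\nabla^2 f$ are the gradient and Hessian of $f$; $Id$ is the $m\times m$ identity matrix. For a symmetric real matrix $A$, $minsp(A):=\min_{\|e\|=1}\|Ae\|$ (equivalently, the minimum of $|\lambda|$ over the eigenvalues $\lambda$ of $A$). Algorithm New Q-Newton's method Backtracking G. Parameters: pairwise distinct real numbers $\delta_0,\ldots,\delta_m$ (chosen randomly, then fixed), $\tau>0$, $0<\gamma_0<1$, and a rule assigning to each $x\in\mathbb{R}^m$ an orthonormal basis $e_1(x),\ldots,e_m(x)$ of $\mathbb{R}^m$. Put $\kappa:=\frac12\min_{i\ne j}|\delta_i-\delta_j|$. Starting from $x_0\in\mathbb{R}^m$, for $k=0,1,2,\ldots$: if $\nabla f(x_k)=0$, put $x_{k+1}=x_k$. If $\nabla f(x_k)\neq 0$: - let $j$ be the smallest index in $\{0,\ldots,m\}$ with $minsp(\nabla^2 f(x_k)+\delta_j\|\nabla f(x_k)\|^{\tau}Id)\ge\kappa\|\nabla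 f(x_k)\|^{\tau}$, and put $A_k:=\nabla^2 f(x_k)+\delta_j\|\nabla f(x_k)\|^{\tau}Id$; - put $e_{i,k}:=e_i(x_k)$, $w_k:=\sum_{i=1}^m\frac{\langle\nabla f(x_k),e_{i,k}\rangle}{\|A_ke_{i,k}\|}e_{i,k}$ and $\widehat{w_k}:=w_k/\max\{1,\|w_k\|\}$; - let $\gamma$ be the first element of the sequence $\gamma_0,\gamma_0/3,\gamma_0/9,\ldots$ satisfying Armijo's condition $f(x_k-\gamma\widehat{w_k})-f(x_k)\le-\frac13\gamma\langle\widehat{w_k},\nabla f(x_k)\rangle$; - put $x_{k+1}:=x_k-\gamma\widehat{w_k}$. Terminology. $f$ is Morse if every critical point of $f$ is non-degenerate, i.e. $\nabla f(x^* )=0$ implies that $\nabla^2 f(x^* )$ is invertible. $f$ has compact sublevels if $\{x\in\mathbb{R}^m: f(x)\le a\}$ is compact for every $a\in\mathbb{R}$. *)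

theory Defs
  imports "HOL-Analysis.Analysis"
begin

text \<open>
  The dimension \<open>m\<close> is \<^term>\<open>CARD('n)\<close>, so \<open>\<real>\<^sup>m\<close> is \<^typ>\<open>real^'n\<close> with \<open>m \<ge> 1\<close>.
\<close>

text \<open>
  \<open>C\<^sup>k\<close> on the whole space: Frechet differentiable everywhere, with all directional derivatives
  (equivalently, all partial derivatives) of class \<open>C\<^bsup>k-1\<^esup>\<close>.
\<close>
primrec C_k :: "nat \<Rightarrow> ('a::real_normed_vector \<Rightarrow> 'b::real_normed_vector) \<Rightarrow> bool" where
  "C_k 0 f \<longleftrightarrow> continuous_on UNIV f"
| "C_k (Suc k) f \<longleftrightarrow>
    (\<forall>x. f differentiable (at x)) \<and> (\<forall>v. C_k k (\<lambda>x. frechet_derivative f (at x) v))"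

definition gradient :: "(real^'n \<Rightarrow> real) \<Rightarrow> real^'n \<Rightarrow> real^'n" where
  "gradient f x = (\<chi> i. frechet_derivative f (at x) (axis i 1))"

definition hessian :: "(real^'n \<Rightarrow> real) \<Rightarrow> real^'n \<Rightarrow> real^'n^'n" where
  "hessian f x = jacobian (gradient f) (at x)"

definition morse :: "(real^'n \<Rightarrow> real) \<Rightarrow> bool" where
  "morse f \<longleftrightarrow> (\<forall>x. gradient f x = 0 \<longrightarrow> invertible (hessian f x))"

definition compact_sublevels :: "('a::topological_space \<Rightarrow> real) \<Rightarrow> bool" where
  "compact_sublevels f \<longleftrightarrow> (\<forall>a. compact {x. f x \<le> a})"

definition orthonormal_basis :: "('n \<Rightarrow> real^'n) \<Rightarrow> bool" where
  "orthonormal_basis b \<longleftrightarrow>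
    (\<forall>i j. b i \<bullet> b j = (if i = j then 1 else 0)) \<and> span (range b) = UNIV"

text \<open>The infimum is a minimum, the unit sphere being compact and nonempty.\<close>
definition minsp :: "real^'n^'n \<Rightarrow> real" where
  "minsp A = (INF u\<in>sphere 0 1. norm (A *v u))"

text \<open>
  In the algorithm below, only the values of \<open>\<delta>\<close> on \<open>{0..m}\<close> are used. Both \<open>LEAST\<close> operators
  (for the index \<open>j\<close> and for the exponent \<open>l\<close> in \<open>\<gamma> = \<gamma>\<^sub>0 / 3 ^ l\<close>) are meant for \<open>gradient f x \<noteq> 0\<close>.
\<close>

definition nqn_kappa :: "'n itself \<Rightarrow> (nat \<Rightarrow> real) \<Rightarrow> real" where
  "nqn_kappa _ \<delta> = 1 / 2 * Min {\<bar>\<delta> i - \<delta> j\<bar> | i j. i \<le> CARD('n) \<and> j \<le> CARD('n) \<and> i \<noteq> j}"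

definition nqn_shift ::
    "(real^'n \<Rightarrow> real) \<Rightarrow> (nat \<Rightarrow> real) \<Rightarrow> real \<Rightarrow> nat \<Rightarrow> real^'n \<Rightarrow> real^'n^'n" where
  "nqn_shift f \<delta> \<tau> j x = hessian f x + (\<delta> j * norm (gradient f x) powr \<tau>) *\<^sub>R mat 1"

definition nqn_index ::
    "(real^'n \<Rightarrow> real) \<Rightarrow> (nat \<Rightarrow> real) \<Rightarrow> real \<Rightarrow> real^'n \<Rightarrow> nat" where
  "nqn_index f \<delta> \<tau> x =
    (LEAST j. j \<le> CARD('n) \<and>
       minsp (nqn_shift f \<delta> \<tau> j x) \<ge> nqn_kappa TYPE('n) \<delta> * norm (gradient f x) powr \<tau>)"

definition nqn_matrix ::
    "(real^'n \<Rightarrow> real) \<Rightarrow> (nat \<Rightarrow> real) \<Rightarrow> real \<Rightarrow> real^'n \<Rightarrow> real^'n^'n" where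
  "nqn_matrix f \<delta> \<tau> x = nqn_shift f \<delta> \<tau> (nqn_index f \<delta> \<tau> x) x"

definition nqn_w ::
    "(real^'n \<Rightarrow> real) \<Rightarrow> (nat \<Rightarrow> real) \<Rightarrow> real \<Rightarrow> (real^'n \<Rightarrow> 'n \<Rightarrow> real^'n) \<Rightarrow> real^'n \<Rightarrow> real^'n" where
  "nqn_w f \<delta> \<tau> e x =
    (\<Sum>i\<in>UNIV. ((gradient f x \<bullet> e x i) / norm (nqn_matrix f \<delta> \<tau> x *v e x i)) *\<^sub>R e x i)"

definition nqn_w_hat ::
    "(real^'n \<Rightarrow> real) \<Rightarrow> (nat \<Rightarrow> real) \<Rightarrow> real \<Rightarrow> (real^'n \<Rightarrow> 'n \<Rightarrow> real^'n) \<Rightarrow> real^'n \<Rightarrow> real^'n" where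
  "nqn_w_hat f \<delta> \<tau> e x = nqn_w f \<delta> \<tau> e x /\<^sub>R max 1 (norm (nqn_w f \<delta> \<tau> e x))"

definition armijo :: "(real^'n \<Rightarrow> real) \<Rightarrow> real^'n \<Rightarrow> real^'n \<Rightarrow> real \<Rightarrow> bool" where
  "armijo f x w \<gamma> \<longleftrightarrow> f (x - \<gamma> *\<^sub>R w) - f x \<le> - (1 / 3) * \<gamma> * (w \<bullet> gradient f x)"

definition armijo_step :: "(real^'n \<Rightarrow> real) \<Rightarrow> real \<Rightarrow> real^'n \<Rightarrow> real^'n \<Rightarrow> real" where
  "armijo_step f \<gamma>\<^sub>0 x w = \<gamma>\<^sub>0 / 3 ^ (LEAST l. armijo f x w (\<gamma>\<^sub>0 / 3 ^ l))"

definition nqn_next ::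
    "(real^'n \<Rightarrow> real) \<Rightarrow> (nat \<Rightarrow> real) \<Rightarrow> real \<Rightarrow> real \<Rightarrow> (real^'n \<Rightarrow> 'n \<Rightarrow> real^'n) \<Rightarrow> real^'n \<Rightarrow> real^'n"
  where
  "nqn_next f \<delta> \<tau> \<gamma>\<^sub>0 e x =
    (if gradient f x = 0 then x
     else let w = nqn_w_hat f \<delta> \<tau> e x in x - armijo_step f \<gamma>\<^sub>0 x w *\<^sub>R w)"

primrec nqn_seq ::
    "(real^'n \<Rightarrow> real) \<Rightarrow> (nat \<Rightarrow> real) \<Rightarrow> real \<Rightarrow> real \<Rightarrow> (real^'n \<Rightarrow> 'n \<Rightarrow> real^'n) \<Rightarrow> real^'n \<Rightarrow>
      nat \<Rightarrow> real^'n" where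
  "nqn_seq f \<delta> \<tau> \<gamma>\<^sub>0 e x\<^sub>0 0 = x\<^sub>0"
| "nqn_seq f \<delta> \<tau> \<gamma>\<^sub>0 e x\<^sub>0 (Suc k) = nqn_next f \<delta> \<tau> \<gamma>\<^sub>0 e (nqn_seq f \<delta> \<tau> \<gamma>\<^sub>0 e x\<^sub>0 k)"

end

theory Submission imports Defs begin

text \<open>
  No random choice of the initial point is needed: the exceptional set can be taken empty.
  The values \<open>f (x n)\<close> decrease. Near a noncritical point the shift index guarantees a lower bound on
  \<open>minsp (A x)\<close>, hence on the slope along \<open>w_hat x\<close> and on the Armijo step, so that \<open>f\<close> drops by
  a fixed amount there; consequently every cluster point of \<open>x\<close> is critical. At a nondegenerate
  critical point \<open>p\<close> the matrices \<open>A x\<close> stay uniformly invertible while the gradient vanishes, so the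
  steps tend to \<open>0\<close> near \<open>p\<close>. As \<open>p\<close> is isolated among the critical points, a sequence that clusters
  at \<open>p\<close> cannot leave a small ball around \<open>p\<close> without clustering at a noncritical point.
\<close>

section \<open>Symmetry of the second derivative\<close>

lemma second_difference_estimate:
  fixes f :: "'a::real_inner \<Rightarrow> real"
  assumes f: "\<And>y. (f has_derivative (\<lambda>h. g y \<bullet> h)) (at y)"
    and g: "(g has_derivative g') (at x)"
    and "\<epsilon> > 0"
  shows "\<exists>d>0. \<forall>t. 0 < t \<and> t < d \<longrightarrow>
    \<bar>f (x + t *\<^sub>R u + t *\<^sub>R v) - f (x + t *\<^sub>R u) - f (x + t *\<^sub>R v) + f x - t\<^sup>2 * (g' v \<bullet> u)\<bar> \<le> \<epsilon> * t\<^sup>2"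
proof -
  interpret g': bounded_linear g' using g by (rule has_derivative_bounded_linear)
  define M where "M = norm u * (2 * norm u + norm v) + 1"
  have M: "M > 0" unfolding M_def by (intro add_nonneg_pos mult_nonneg_nonneg) auto
  define \<epsilon>' where "\<epsilon>' = \<epsilon> / M"
  have "\<epsilon>' > 0" using M \<open>\<epsilon> > 0\<close> by (simp add: \<epsilon>'_def)
  then obtain d0 where d0: "d0 > 0"
    "\<And>y. norm (y - x) < d0 \<Longrightarrow> norm (g y - g x - g' (y - x)) \<le> \<epsilon>' * norm (y - x)"
    using g unfolding has_derivative_at_alt by blast
  define d where "d = d0 / (norm u + norm v + 1)"
  have pos: "norm u + norm v + 1 > 0" by (intro add_nonneg_pos) auto
  have "d > 0" using d0 pos by (simp add: d_def)
  moreover have "\<bar>f (x + t *\<^sub>R u + t *\<^sub>R v) - f (x + t *\<^sub>R u) - f (x + t *\<^sub>R v) + f x - t\<^sup>2 * (g' v \<bullet> u)\<bar>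
      \<le> \<epsilon> * t\<^sup>2" if t: "0 < t" "t < d" for t
  proof -
    define \<phi> where "\<phi> s = f (x + t *\<^sub>R v + (s * t) *\<^sub>R u) - f (x + (s * t) *\<^sub>R u)" for s :: real
    have f_line: "((\<lambda>s. f (z + (s * t) *\<^sub>R u)) has_derivative (\<lambda>h. g (z + (s * t) *\<^sub>R u) \<bullet> ((h * t) *\<^sub>R u))) (at s)"
      for z s
      by (rule has_derivative_compose[OF _ f, of _ _ _ UNIV]) (auto intro!: derivative_eq_intros)
    have "(\<phi> has_derivative (\<lambda>h. h * (t * ((g (x + t *\<^sub>R v + (s * t) *\<^sub>R u) - g (x + (s * t) *\<^sub>R u)) \<bullet> u)))) (at s)" for s
      unfolding \<phi>_def
      by (rule has_derivative_eq_rhs[OF has_derivative_diff[OF f_line f_line]])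
        (auto simp: algebra_simps inner_diff_left)
    then have "\<exists>s\<in>{0<..<1}. \<phi> 1 - \<phi> 0 = (1 - 0) * (t * ((g (x + t *\<^sub>R v + (s * t) *\<^sub>R u) - g (x + (s * t) *\<^sub>R u)) \<bullet> u))"
      by (intro mvt_simple) (auto intro: has_derivative_at_withinI)
    then obtain s where s: "0 < s" "s < 1"
      and \<phi>: "\<phi> 1 - \<phi> 0 = t * ((g (x + t *\<^sub>R v + (s * t) *\<^sub>R u) - g (x + (s * t) *\<^sub>R u)) \<bullet> u)"
      by auto
    define y z where "y = x + t *\<^sub>R v + (s * t) *\<^sub>R u" and "z = x + (s * t) *\<^sub>R u"
    have diff: "f (x + t *\<^sub>R u + t *\<^sub>R v) - f (x + t *\<^sub>R u) - f (x + t *\<^sub>R v) + f x = t * ((g y - g z) \<bullet> u)"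
      using \<phi> by (simp add: \<phi>_def y_def z_def algebra_simps)
    have st: "s * t * norm u \<le> t * norm u"
      using s t by (simp add: mult_left_le_one_le mult_right_mono)
    have ny: "norm (y - x) \<le> t * (norm u + norm v)"
    proof -
      have "norm (y - x) \<le> t * norm v + s * t * norm u"
        using norm_triangle_ineq[of "t *\<^sub>R v" "(s * t) *\<^sub>R u"] s t by (simp add: y_def add.assoc)
      then show ?thesis using st by (simp add: algebra_simps)
    qed
    have nz: "norm (z - x) \<le> t * norm u"
      using s t st by (simp add: z_def)
    have "t * (norm u + norm v + 1) < d0"
      using t pos by (simp add: d_def pos_less_divide_eq)
    moreover have "t * (norm u + norm v) < t * (norm u + norm v + 1)" "t * norm u \<le> t * (norm u + norm v)"
      using t by simp_all
    ultimately have lt: "norm (y - x) < d0" "norm (z - x) < d0"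
      using ny nz by linarith+
    have g'_diff: "g' (t *\<^sub>R v) = g' (y - x) - g' (z - x)"
      by (simp add: y_def z_def flip: g'.diff)
    have "norm (g y - g z - g' (t *\<^sub>R v)) = norm ((g y - g x - g' (y - x)) - (g z - g x - g' (z - x)))"
      unfolding g'_diff by (simp add: algebra_simps)
    also have "\<dots> \<le> \<epsilon>' * norm (y - x) + \<epsilon>' * norm (z - x)"
      by (rule order_trans[OF norm_triangle_ineq4 add_mono[OF d0(2)[OF lt(1)] d0(2)[OF lt(2)]]])
    also have "\<dots> \<le> \<epsilon>' * (t * (norm u + norm v)) + \<epsilon>' * (t * norm u)"
      using ny nz \<open>\<epsilon>' > 0\<close> by (intro add_mono mult_left_mono) auto
    finally have "norm (g y - g z - g' (t *\<^sub>R v)) \<le> \<epsilon>' * t * (2 * norm u + norm v)"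
      by (simp add: algebra_simps)
    then have "\<bar>(g y - g z - g' (t *\<^sub>R v)) \<bullet> u\<bar> \<le> \<epsilon>' * t * (2 * norm u + norm v) * norm u"
      by (rule order_trans[OF Cauchy_Schwarz_ineq2 mult_right_mono[OF _ norm_ge_zero]])
    then have "\<bar>(g y - g z - g' (t *\<^sub>R v)) \<bullet> u\<bar> \<le> \<epsilon>' * t * (M - 1)"
      by (simp add: M_def mult_ac)
    then have "t * \<bar>(g y - g z - g' (t *\<^sub>R v)) \<bullet> u\<bar> \<le> t * (\<epsilon>' * t * (M - 1))"
      using t by (intro mult_left_mono) auto
    also have "\<dots> \<le> t * (\<epsilon>' * t * M)"
      using t \<open>\<epsilon>' > 0\<close> by simp
    also have "\<dots> = \<epsilon> * t\<^sup>2"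
      using M by (simp add: \<epsilon>'_def power2_eq_square)
    finally have "\<bar>t * ((g y - g z - g' (t *\<^sub>R v)) \<bullet> u)\<bar> \<le> \<epsilon> * t\<^sup>2"
      using t by (simp add: abs_mult)
    moreover have "t * ((g y - g z - g' (t *\<^sub>R v)) \<bullet> u) = t * ((g y - g z) \<bullet> u) - t\<^sup>2 * (g' v \<bullet> u)"
      by (simp add: g'.scaleR inner_diff_left power2_eq_square right_diff_distrib)
    ultimately show ?thesis
      by (simp add: diff)
  qed
  ultimately show ?thesis by blast
qed

lemma second_derivative_symmetric:
  fixes f :: "'a::real_inner \<Rightarrow> real"
  assumes f: "\<And>y. (f has_derivative (\<lambda>h. g y \<bullet> h)) (at y)"
    and g: "(g has_derivative g') (at x)"
  shows "g' u \<bullet> v = g' v \<bullet> u"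
proof -
  have "\<bar>g' u \<bullet> v - g' v \<bullet> u\<bar> \<le> 0 + \<epsilon>" if "\<epsilon> > 0" for \<epsilon>
  proof -
    have "\<epsilon> / 2 > 0" using that by simp
    obtain d1 where d1: "d1 > 0" "\<And>t. 0 < t \<Longrightarrow> t < d1 \<Longrightarrow>
      \<bar>f (x + t *\<^sub>R u + t *\<^sub>R v) - f (x + t *\<^sub>R u) - f (x + t *\<^sub>R v) + f x - t\<^sup>2 * (g' v \<bullet> u)\<bar> \<le> \<epsilon> / 2 * t\<^sup>2"
      using second_difference_estimate[OF f g \<open>\<epsilon> / 2 > 0\<close>, of u v] by blast
    obtain d2 where d2: "d2 > 0" "\<And>t. 0 < t \<Longrightarrow> t < d2 \<Longrightarrow>
      \<bar>f (x + t *\<^sub>R v + t *\<^sub>R u) - f (x + t *\<^sub>R v) - f (x + t *\<^sub>R u) + f x - t\<^sup>2 * (g' u \<bullet> v)\<bar> \<le> \<epsilon> / 2 * t\<^sup>2"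
      using second_difference_estimate[OF f g \<open>\<epsilon> / 2 > 0\<close>, of v u] by blast
    define t where "t = min d1 d2 / 2"
    have t: "0 < t" "t < d1" "t < d2" using d1 d2 by (auto simp: t_def)
    have "x + t *\<^sub>R v + t *\<^sub>R u = x + t *\<^sub>R u + t *\<^sub>R v" by simp
    then have "\<bar>t\<^sup>2 * (g' u \<bullet> v) - t\<^sup>2 * (g' v \<bullet> u)\<bar> \<le> \<epsilon> * t\<^sup>2"
      using d1(2)[OF t(1,2)] d2(2)[OF t(1,3)] by (simp only:)
    moreover have "\<bar>t\<^sup>2 * (g' u \<bullet> v) - t\<^sup>2 * (g' v \<bullet> u)\<bar> = t\<^sup>2 * \<bar>g' u \<bullet> v - g' v \<bullet> u\<bar>"
      by (simp add: abs_mult flip: right_diff_distrib)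
    ultimately have "t\<^sup>2 * \<bar>g' u \<bullet> v - g' v \<bullet> u\<bar> \<le> t\<^sup>2 * \<epsilon>"
      by (simp add: mult.commute)
    then show ?thesis using t by simp
  qed
  then show ?thesis using field_le_epsilon[of "\<bar>g' u \<bullet> v - g' v \<bullet> u\<bar>" 0] by simp
qed

section \<open>The minimal absolute eigenvalue of a symmetric matrix\<close>

lemma minsp_mult_norm_le: "norm (A *v u) \<ge> minsp A * norm u"
proof (cases "u = 0")
  case False
  have "bdd_below ((\<lambda>u. norm (A *v u)) ` sphere 0 1)"
    by (auto intro: bdd_belowI[of _ 0])
  then have "minsp A \<le> norm (A *v (u /\<^sub>R norm u))"
    unfolding minsp_def using False by (intro cINF_lower) auto
  also have "\<dots> = norm (A *v u) / norm u"
    by (simp add: matrix_vector_mult_scaleR divide_inverse)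
  finally show ?thesis using False by (simp add: field_simps)
qed simp

lemma minsp_attained: "\<exists>u. norm u = 1 \<and> norm (A *v u) = minsp A"
proof -
  have "norm (axis undefined 1 :: real^'n) = 1" by simp
  then have "sphere 0 1 \<noteq> ({} :: (real^'n) set)" by (metis dist_0_norm empty_iff mem_sphere)
  then obtain u where u: "u \<in> sphere 0 1" "\<And>v. v \<in> sphere 0 1 \<Longrightarrow> norm (A *v u) \<le> norm (A *v v)"
    using continuous_attains_inf[of "sphere 0 1" "\<lambda>u. norm (A *v u)"]
    by (metis compact_sphere continuous_on_norm linear_continuous_on matrix_vector_mul_bounded_linear)
  have "minsp A = norm (A *v u)"
    unfolding minsp_def using u by (intro cInf_eq_minimum) auto
  then show ?thesis using u by auto
qed

lemma minsp_ge:
  assumes "\<And>u. norm u = 1 \<Longrightarrow> c \<le> norm (A *v u)"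
  shows "c \<le> minsp A"
  using minsp_attained[of A] assms by metis

lemma minsp_nonneg: "0 \<le> minsp A"
  by (rule minsp_ge) simp

text \<open>
  A minimizer \<open>u\<close> satisfies \<open>A\<^sup>2 u = \<mu>\<^sup>2 u\<close> by the Lagrange condition, and
  \<open>(A - \<mu>) (A + \<mu>) u = 0\<close> provides the eigenvector.
\<close>
lemma minsp_eigenvalue:
  fixes A :: "real^'n^'n"
  assumes sym: "\<And>u v. (A *v u) \<bullet> v = u \<bullet> (A *v v)"
  shows "\<exists>\<nu> v. v \<noteq> 0 \<and> A *v v = \<nu> *\<^sub>R v \<and> \<bar>\<nu>\<bar> = minsp A"
proof -
  define \<mu> where "\<mu> = minsp A"
  obtain u where u: "norm u = 1" "norm (A *v u) = \<mu>"
    using minsp_attained[of A] by (auto simp: \<mu>_def)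
  have \<mu>: "\<mu> \<ge> 0" by (simp add: \<mu>_def minsp_nonneg)
  have "(A *v (A *v u) - \<mu>\<^sup>2 *\<^sub>R u) \<bullet> v = 0" for v
  proof -
    define b where "b = (A *v (A *v u) - \<mu>\<^sup>2 *\<^sub>R u) \<bullet> v"
    define c where "c = (norm (A *v v))\<^sup>2 - \<mu>\<^sup>2 * (norm v)\<^sup>2"
    have "0 \<le> 2 * t * b + t\<^sup>2 * c" for t
    proof -
      have minimal: "(\<mu> * norm (u + t *\<^sub>R v))\<^sup>2 \<le> (norm (A *v (u + t *\<^sub>R v)))\<^sup>2"
        using minsp_mult_norm_le[of A "u + t *\<^sub>R v"] \<mu> by (intro power_mono) (auto simp: \<mu>_def)
      have square: "(norm (a + t *\<^sub>R c))\<^sup>2 = (norm a)\<^sup>2 + 2 * t * (a \<bullet> c) + t\<^sup>2 * (norm c)\<^sup>2"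
        for a c :: "real^'n"
        unfolding power2_norm_eq_inner
        by (simp add: inner_add power2_eq_square algebra_simps inner_commute)
      have "(norm (A *v (u + t *\<^sub>R v)))\<^sup>2 = \<mu>\<^sup>2 + 2 * t * ((A *v u) \<bullet> (A *v v)) + t\<^sup>2 * (norm (A *v v))\<^sup>2"
        using square[of "A *v u" "A *v v"] by (simp add: u matrix_vector_right_distrib matrix_vector_mult_scaleR)
      moreover have "(\<mu> * norm (u + t *\<^sub>R v))\<^sup>2 = \<mu>\<^sup>2 + 2 * t * (\<mu>\<^sup>2 * (u \<bullet> v)) + t\<^sup>2 * (\<mu>\<^sup>2 * (norm v)\<^sup>2)"
        by (simp add: power_mult_distrib square u algebra_simps)
      moreover have b: "(A *v u) \<bullet> (A *v v) = b + \<mu>\<^sup>2 * (u \<bullet> v)"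
        by (simp add: b_def inner_diff_left sym)
      ultimately show ?thesis
        using minimal by (simp add: c_def algebra_simps)
    qed
    have "b = 0"
    proof (rule ccontr)
      assume "b \<noteq> 0"
      define t where "t = - b / (\<bar>c\<bar> + 1)"
      have "t * (2 * b + t * c) \<ge> 0"
        using \<open>\<And>t. 0 \<le> 2 * t * b + t\<^sup>2 * c\<close>[of t] by (simp add: algebra_simps power2_eq_square)
      moreover have "2 * b + t * c = b * (2 * \<bar>c\<bar> + 2 - c) / (\<bar>c\<bar> + 1)"
        by (simp add: t_def field_simps add_pos_nonneg)
      moreover have "t * (b * (2 * \<bar>c\<bar> + 2 - c) / (\<bar>c\<bar> + 1)) = - (b\<^sup>2 * (2 * \<bar>c\<bar> + 2 - c) / (\<bar>c\<bar> + 1)\<^sup>2)"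
        by (simp add: t_def power2_eq_square)
      moreover have "b\<^sup>2 * (2 * \<bar>c\<bar> + 2 - c) / (\<bar>c\<bar> + 1)\<^sup>2 > 0"
        using \<open>b \<noteq> 0\<close> by (intro divide_pos_pos mult_pos_pos) (auto simp: add_pos_nonneg)
      ultimately show False by simp
    qed
    then show ?thesis by (simp add: b_def)
  qed
  then have sq: "A *v (A *v u) = \<mu>\<^sup>2 *\<^sub>R u"
    by (metis eq_iff_diff_eq_0 inner_eq_zero_iff)
  define v where "v = A *v u + \<mu> *\<^sub>R u"
  have Av: "A *v v = \<mu> *\<^sub>R v"
    by (simp add: v_def matrix_vector_right_distrib matrix_vector_mult_scaleR sq power2_eq_square scaleR_add_right)
  show ?thesis
  proof (cases "v = 0")
    case True
    then have "A *v u = (- \<mu>) *\<^sub>R u" by (simp add: v_def eq_neg_iff_add_eq_0)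
    moreover have "u \<noteq> 0" using u by auto
    ultimately show ?thesis using \<mu> \<mu>_def by (metis abs_minus_cancel abs_of_nonneg)
  next
    case False
    then show ?thesis using Av \<mu> \<mu>_def by (metis abs_of_nonneg)
  qed
qed

text \<open>
  Otherwise every shift \<open>\<delta> j * s\<close> would be within \<open>\<kappa> * s\<close> of the negative of an eigenvalue of \<open>H\<close>,
  giving \<open>m + 1\<close> distinct eigenvalues and hence \<open>m + 1\<close> orthogonal eigenvectors.
\<close>
lemma minsp_shift_pigeonhole:
  fixes H :: "real^'n^'n"
  assumes sym: "\<And>u v. (H *v u) \<bullet> v = u \<bullet> (H *v v)"
    and sep: "\<And>i j. i \<le> CARD('n) \<Longrightarrow> j \<le> CARD('n) \<Longrightarrow> i \<noteq> j \<Longrightarrow> 2 * \<kappa> \<le> \<bar>\<delta> i - \<delta> j\<bar>"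
    and "s \<ge> 0"
  shows "\<exists>j\<le>CARD('n). \<kappa> * s \<le> minsp (H + (\<delta> j * s) *\<^sub>R mat 1)"
proof (rule ccontr)
  assume "\<not> ?thesis"
  then have less: "minsp (H + (\<delta> j * s) *\<^sub>R mat 1) < \<kappa> * s" if "j \<le> CARD('n)" for j
    using that by (meson not_le)
  have mult: "(H + c *\<^sub>R mat 1) *v v = H *v v + c *\<^sub>R v" for c and v :: "real^'n"
    by (simp add: matrix_vector_mult_add_rdistrib flip: scaleR_matrix_vector_assoc)
  have "\<exists>\<nu> v. v \<noteq> 0 \<and> H *v v = \<nu> *\<^sub>R v \<and> \<bar>\<nu> + \<delta> j * s\<bar> < \<kappa> * s" if j: "j \<le> CARD('n)" for j
  proof -
    obtain \<nu> v where v: "v \<noteq> 0" "(H + (\<delta> j * s) *\<^sub>R mat 1) *v v = \<nu> *\<^sub>R v"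
        "\<bar>\<nu>\<bar> = minsp (H + (\<delta> j * s) *\<^sub>R mat 1)"
      using minsp_eigenvalue[of "H + (\<delta> j * s) *\<^sub>R mat 1"]
      by (auto simp: mult inner_add sym)
    then have "H *v v = (\<nu> - \<delta> j * s) *\<^sub>R v"
      by (simp add: mult scaleR_diff_left eq_diff_eq)
    then show ?thesis using v less[OF j] by (intro exI[of _ "\<nu> - \<delta> j * s"] exI[of _ v]) auto
  qed
  then obtain \<nu> v where v: "\<And>j. j \<le> CARD('n) \<Longrightarrow> v j \<noteq> 0"
      "\<And>j. j \<le> CARD('n) \<Longrightarrow> H *v v j = \<nu> j *\<^sub>R v j"
      "\<And>j. j \<le> CARD('n) \<Longrightarrow> \<bar>\<nu> j + \<delta> j * s\<bar> < \<kappa> * s"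
    by metis
  have orth: "v i \<bullet> v j = 0" if ij: "i \<le> CARD('n)" "j \<le> CARD('n)" "i \<noteq> j" for i j
  proof -
    have "\<nu> i \<noteq> \<nu> j"
    proof
      assume "\<nu> i = \<nu> j"
      then have "\<bar>\<delta> i * s - \<delta> j * s\<bar> < 2 * \<kappa> * s"
        using v(3)[OF ij(1)] v(3)[OF ij(2)] by linarith
      moreover have "\<bar>\<delta> i * s - \<delta> j * s\<bar> = \<bar>\<delta> i - \<delta> j\<bar> * s"
        using \<open>s \<ge> 0\<close> by (simp add: abs_mult flip: left_diff_distrib)
      ultimately show False
        using mult_right_mono[OF sep[OF ij] \<open>s \<ge> 0\<close>] by linarith
    qed
    moreover have "\<nu> i * (v i \<bullet> v j) = \<nu> j * (v i \<bullet> v j)"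
      using sym[of "v i" "v j"] ij by (simp add: v)
    ultimately show ?thesis by simp
  qed
  have "inj_on v {..CARD('n)}"
    using orth v(1) by (intro inj_onI) (metis atMost_iff inner_eq_zero_iff)
  then have "card (v ` {..CARD('n)}) = CARD('n) + 1"
    by (simp add: card_image)
  moreover have "pairwise orthogonal (v ` {..CARD('n)})"
    by (auto simp: pairwise_def orthogonal_def) (metis orth)
  then have "independent (v ` {..CARD('n)})"
    using v(1) by (intro pairwise_orthogonal_independent) auto
  then have "card (v ` {..CARD('n)}) \<le> CARD('n)"
    using independent_bound by fastforce
  ultimately show False by simp
qed

section \<open>Gradient and Hessian\<close>

lemma C_k_Suc_imp_continuous_on: "C_k (Suc k) f \<Longrightarrow> continuous_on UNIV f"
  by (auto intro!: differentiable_imp_continuous_on simp: differentiable_on_def differentiable_at_withinI)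

lemma C_k_Suc_imp_C_k: "C_k (Suc k) f \<Longrightarrow> C_k k f"
proof (induction k arbitrary: f)
  case 0
  then show ?case using C_k_Suc_imp_continuous_on[of 0 f] by simp
next
  case (Suc k)
  then show ?case by (metis C_k.simps(2))
qed

lemma has_derivative_gradient:
  fixes f :: "real^'n \<Rightarrow> real"
  assumes "f differentiable (at x)"
  shows "(f has_derivative (\<lambda>h. gradient f x \<bullet> h)) (at x)"
proof -
  let ?F = "frechet_derivative f (at x)"
  have F: "(f has_derivative ?F) (at x)"
    using assms by (simp add: frechet_derivative_works)
  then interpret F: linear ?F by (rule has_derivative_linear)
  have "?F h = gradient f x \<bullet> h" for h
  proof -
    have "?F h = ?F (\<Sum>i\<in>UNIV. h $ i *\<^sub>R axis i 1)"
      using basis_expansion[of h] by (simp add: scalar_mult_eq_scaleR)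
    also have "\<dots> = gradient f x \<bullet> h"
      by (simp add: F.sum F.scale gradient_def inner_vec_def mult.commute)
    finally show ?thesis .
  qed
  then have "?F = (\<lambda>h. gradient f x \<bullet> h)" by (rule ext)
  with F show ?thesis by simp
qed

lemma gradient_component: "gradient f x $ i = frechet_derivative f (at x) (axis i 1)"
  by (simp add: gradient_def)

lemma has_derivative_hessian:
  fixes f :: "real^'n \<Rightarrow> real"
  assumes "C_k 2 f"
  shows "(gradient f has_derivative (\<lambda>h. hessian f x *v h)) (at x)"
proof -
  have "(\<lambda>y. gradient f y \<bullet> b) differentiable (at x)" if "b \<in> Basis" for b
  proof -
    obtain i where "b = axis i 1" using \<open>b \<in> Basis\<close> by (auto simp: Basis_vec_def)
    then show ?thesis
      using assms by (simp add: inner_axis gradient_component eval_nat_numeral)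
  qed
  then have "gradient f differentiable (at x)"
    by (subst differentiable_componentwise_within) auto
  then show ?thesis by (simp add: hessian_def jacobian_works)
qed

lemma hessian_component:
  fixes f :: "real^'n \<Rightarrow> real"
  assumes "C_k 2 f"
  shows "hessian f x $ i $ j =
    frechet_derivative (\<lambda>y. frechet_derivative f (at y) (axis i 1)) (at x) (axis j 1)"
proof -
  have "((\<lambda>y. gradient f y $ i) has_derivative (\<lambda>h. (hessian f x *v h) $ i)) (at x)"
    using bounded_linear.has_derivative[OF bounded_linear_vec_nth has_derivative_hessian[OF assms]] .
  then have "frechet_derivative (\<lambda>y. gradient f y $ i) (at x) = (\<lambda>h. (hessian f x *v h) $ i)"
    by (metis frechet_derivative_at)
  then show ?thesis
    by (simp add: gradient_component matrix_vector_mul_component inner_axis)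
qed

lemma continuous_on_hessian:
  fixes f :: "real^'n \<Rightarrow> real"
  assumes "C_k 3 f"
  shows "continuous_on UNIV (hessian f)"
proof -
  have "C_k 2 f"
    using assms C_k_Suc_imp_C_k[of 2 f] by (simp add: eval_nat_numeral)
  have "continuous_on UNIV (\<lambda>x. hessian f x $ i $ j)" for i j
    unfolding hessian_component[OF \<open>C_k 2 f\<close>]
    using assms by (intro C_k_Suc_imp_continuous_on[of 0]) (simp add: eval_nat_numeral)
  then have "continuous_on UNIV (\<lambda>x. \<chi> i j. hessian f x $ i $ j)"
    by (intro continuous_on_vec_lambda)
  then show ?thesis by simp
qed

lemma hessian_symmetric:
  fixes f :: "real^'n \<Rightarrow> real"
  assumes "C_k 2 f"
  shows "(hessian f x *v u) \<bullet> v = u \<bullet> (hessian f x *v v)"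
proof -
  have "(f has_derivative (\<lambda>h. gradient f y \<bullet> h)) (at y)" for y
    using assms by (intro has_derivative_gradient) (simp add: eval_nat_numeral)
  from second_derivative_symmetric[OF this has_derivative_hessian[OF assms]]
  show ?thesis by (simp add: inner_commute)
qed

section \<open>Descent directions and line search\<close>

lemma orthonormal_basis_inner: "orthonormal_basis b \<Longrightarrow> b i \<bullet> b j = (if i = j then 1 else 0)"
  by (simp add: orthonormal_basis_def)

lemma orthonormal_basis_norm: "orthonormal_basis b \<Longrightarrow> norm (b i) = 1"
  by (simp add: norm_eq_1 orthonormal_basis_inner)

lemma orthonormal_basis_inner_sum:
  assumes "orthonormal_basis b"
  shows "(\<Sum>i\<in>UNIV. c i *\<^sub>R b i) \<bullet> (\<Sum>i\<in>UNIV. d i *\<^sub>R b i) = (\<Sum>i\<in>UNIV. c i * d i)"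
proof -
  have "(\<Sum>i\<in>UNIV. c i *\<^sub>R b i) \<bullet> (\<Sum>i\<in>UNIV. d i *\<^sub>R b i) = (\<Sum>i\<in>UNIV. d i * c i)"
    using assms
    by (simp add: inner_sum_left inner_sum_right orthonormal_basis_inner if_distrib cong: if_cong)
  then show ?thesis by (simp only: mult.commute)
qed

lemma orthonormal_basis_expansion:
  assumes "orthonormal_basis b"
  shows "(\<Sum>i\<in>UNIV. (v \<bullet> b i) *\<^sub>R b i) = v"
proof -
  define u where "u = v - (\<Sum>i\<in>UNIV. (v \<bullet> b i) *\<^sub>R b i)"
  have "orthogonal u (b j)" for j
    using assms
    by (simp add: u_def orthogonal_def inner_diff_left inner_sum_left orthonormal_basis_inner
        if_distrib cong: if_cong)
  moreover have "u \<in> span (range b)"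
    using assms by (simp add: orthonormal_basis_def)
  ultimately have "orthogonal u u"
    by (metis orthogonal_to_span rangeE)
  then show ?thesis by (simp add: orthogonal_self u_def)
qed

lemma weighted_direction_bounds:
  fixes g :: "real^'n"
  assumes b: "orthonormal_basis b"
    and "\<mu> > 0" and ge: "\<And>i. \<mu> \<le> a i" and le: "\<And>i. a i \<le> B"
    and w: "w = (\<Sum>i\<in>UNIV. ((g \<bullet> b i) / a i) *\<^sub>R b i)"
  shows "(norm g)\<^sup>2 / B \<le> w \<bullet> g" "\<mu> * (norm w)\<^sup>2 \<le> w \<bullet> g" "norm w \<le> norm g / \<mu>"
proof -
  have a: "a i > 0" for i using \<open>\<mu> > 0\<close> ge[of i] by simp
  have gg: "(norm g)\<^sup>2 = (\<Sum>i\<in>UNIV. (g \<bullet> b i)\<^sup>2)"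
    using orthonormal_basis_inner_sum[OF b, of "\<lambda>i. g \<bullet> b i" "\<lambda>i. g \<bullet> b i"]
    unfolding power2_norm_eq_inner by (simp add: orthonormal_basis_expansion[OF b] power2_eq_square)
  have wg: "w \<bullet> g = (\<Sum>i\<in>UNIV. (g \<bullet> b i)\<^sup>2 / a i)"
    using orthonormal_basis_inner_sum[OF b, of "\<lambda>i. (g \<bullet> b i) / a i" "\<lambda>i. g \<bullet> b i"]
    by (simp add: orthonormal_basis_expansion[OF b] power2_eq_square flip: w)
  have ww: "(norm w)\<^sup>2 = (\<Sum>i\<in>UNIV. ((g \<bullet> b i) / a i)\<^sup>2)"
    unfolding power2_norm_eq_inner w by (simp only: orthonormal_basis_inner_sum[OF b] power2_eq_square)
  show "(norm g)\<^sup>2 / B \<le> w \<bullet> g"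
    unfolding gg wg sum_divide_distrib using a le by (intro sum_mono divide_left_mono)
      (auto intro!: mult_pos_pos intro: less_le_trans)
  show "\<mu> * (norm w)\<^sup>2 \<le> w \<bullet> g"
    unfolding ww wg sum_distrib_left
  proof (rule sum_mono)
    fix i
    have "\<mu> * ((g \<bullet> b i) / a i)\<^sup>2 \<le> a i * ((g \<bullet> b i) / a i)\<^sup>2"
      using ge by (intro mult_right_mono) auto
    also have "\<dots> = (g \<bullet> b i)\<^sup>2 / a i"
      using a[of i] by (simp add: power2_eq_square)
    finally show "\<mu> * ((g \<bullet> b i) / a i)\<^sup>2 \<le> (g \<bullet> b i)\<^sup>2 / a i" .
  qed
  then have "\<mu> * (norm w)\<^sup>2 \<le> norm w * norm g"
    using norm_cauchy_schwarz[of w g] by linarith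
  then show "norm w \<le> norm g / \<mu>"
    using \<open>\<mu> > 0\<close> by (cases "w = 0") (auto simp: field_simps power2_eq_square)
qed

lemma armijo_if_small:
  fixes f :: "real^'n \<Rightarrow> real"
  assumes f: "\<And>y. f differentiable (at y)"
    and lip: "\<And>y. y \<in> closed_segment x (x - \<gamma> *\<^sub>R w) \<Longrightarrow>
      norm (gradient f y - gradient f x) \<le> L * norm (y - x)"
    and "\<gamma> \<ge> 0" "L \<ge> 0"
    and w: "\<mu> * (norm w)\<^sup>2 \<le> w \<bullet> gradient f x"
    and small: "L * \<gamma> \<le> 2 / 3 * \<mu>"
  shows "armijo f x w \<gamma>"
proof -
  define \<phi> where "\<phi> t = f (x - t *\<^sub>R w)" for t
  have \<phi>: "(\<phi> has_real_derivative - (gradient f (x - t *\<^sub>R w) \<bullet> w)) (at t)" for t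
    unfolding \<phi>_def has_field_derivative_def
    by (rule has_derivative_eq_rhs[OF has_derivative_compose[OF _ has_derivative_gradient[OF f]]])
      (auto intro!: derivative_eq_intros simp: fun_eq_iff)
  show ?thesis
  proof (cases "\<gamma> = 0")
    case False
    then have "\<gamma> > 0" using \<open>\<gamma> \<ge> 0\<close> by simp
    then obtain t where t: "0 < t" "t < \<gamma>" "\<phi> \<gamma> - \<phi> 0 = (\<gamma> - 0) * - (gradient f (x - t *\<^sub>R w) \<bullet> w)"
      using MVT2[of 0 \<gamma> \<phi> "\<lambda>t. - (gradient f (x - t *\<^sub>R w) \<bullet> w)"] \<phi> by auto
    define y where "y = x - t *\<^sub>R w"
    have "y = (1 - t / \<gamma>) *\<^sub>R x + (t / \<gamma>) *\<^sub>R (x - \<gamma> *\<^sub>R w)"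
      using \<open>\<gamma> > 0\<close> by (simp add: y_def algebra_simps)
    then have "y \<in> closed_segment x (x - \<gamma> *\<^sub>R w)"
      unfolding in_segment using t by (intro exI[of _ "t / \<gamma>"]) auto
    then have "norm (gradient f y - gradient f x) \<le> L * (t * norm w)"
      using lip[of y] t by (simp add: y_def)
    also have "\<dots> \<le> L * (\<gamma> * norm w)"
      using t \<open>L \<ge> 0\<close> by (intro mult_left_mono mult_right_mono) auto
    finally have "norm (gradient f y - gradient f x) * norm w \<le> L * \<gamma> * (norm w)\<^sup>2"
      using mult_right_mono[of _ _ "norm w"] by (fastforce simp: power2_eq_square algebra_simps)
    also have "\<dots> \<le> 2 / 3 * \<mu> * (norm w)\<^sup>2"
      using small by (intro mult_right_mono) auto
    also have "\<dots> \<le> 2 / 3 * (w \<bullet> gradient f x)"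
      using w by simp
    finally have "\<bar>(gradient f y - gradient f x) \<bullet> w\<bar> \<le> 2 / 3 * (w \<bullet> gradient f x)"
      by (rule order_trans[OF Cauchy_Schwarz_ineq2])
    then have "- ((gradient f y - gradient f x) \<bullet> w) \<le> 2 / 3 * (w \<bullet> gradient f x)"
      by linarith
    then have "- (gradient f y \<bullet> w) \<le> - (1 / 3) * (w \<bullet> gradient f x)"
      unfolding inner_diff_left by (simp add: inner_commute)
    then have "\<gamma> * - (gradient f y \<bullet> w) \<le> \<gamma> * (- (1 / 3) * (w \<bullet> gradient f x))"
      using \<open>\<gamma> > 0\<close> by (intro mult_left_mono) auto
    moreover have "f (x - \<gamma> *\<^sub>R w) - f x = \<gamma> * - (gradient f y \<bullet> w)"
      using t by (simp add: \<phi>_def y_def)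
    ultimately show ?thesis
      by (simp add: armijo_def)
  qed (simp add: armijo_def)
qed

text \<open>
  If the minimal exponent is positive, then the threefold step was rejected; otherwise the step is \<open>\<gamma>\<^sub>0\<close>.
\<close>
lemma armijo_step_bounds:
  assumes "\<gamma>\<^sub>0 > 0" "c > 0"
    and acc: "\<And>\<gamma>. 0 < \<gamma> \<Longrightarrow> \<gamma> \<le> \<gamma>\<^sub>0 \<Longrightarrow> \<gamma> \<le> c \<Longrightarrow> armijo f x w \<gamma>"
  shows "armijo f x w (armijo_step f \<gamma>\<^sub>0 x w)" "min \<gamma>\<^sub>0 (c / 3) \<le> armijo_step f \<gamma>\<^sub>0 x w"
    "armijo_step f \<gamma>\<^sub>0 x w \<le> \<gamma>\<^sub>0"
proof -
  define l where "l = (LEAST l. armijo f x w (\<gamma>\<^sub>0 / 3 ^ l))"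
  have step: "armijo_step f \<gamma>\<^sub>0 x w = \<gamma>\<^sub>0 / 3 ^ l" by (simp add: armijo_step_def l_def)
  have le: "\<gamma>\<^sub>0 / 3 ^ k \<le> \<gamma>\<^sub>0" for k :: nat
    using \<open>\<gamma>\<^sub>0 > 0\<close> by (simp add: divide_le_eq mult_le_cancel_left1)
  obtain k :: nat where k: "(1 / 3 :: real) ^ k < c / \<gamma>\<^sub>0"
    using real_arch_pow_inv[of "c / \<gamma>\<^sub>0" "1 / 3"] assms by auto
  then have "\<gamma>\<^sub>0 / 3 ^ k \<le> c"
    using \<open>\<gamma>\<^sub>0 > 0\<close> by (simp add: power_divide field_simps)
  then have "armijo f x w (\<gamma>\<^sub>0 / 3 ^ k)"
    using acc le \<open>\<gamma>\<^sub>0 > 0\<close> by simp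
  then show "armijo f x w (armijo_step f \<gamma>\<^sub>0 x w)"
    unfolding step l_def by (rule LeastI)
  show "armijo_step f \<gamma>\<^sub>0 x w \<le> \<gamma>\<^sub>0" unfolding step by (rule le)
  show "min \<gamma>\<^sub>0 (c / 3) \<le> armijo_step f \<gamma>\<^sub>0 x w"
  proof (cases l)
    case (Suc k)
    then have "\<not> armijo f x w (\<gamma>\<^sub>0 / 3 ^ k)"
      using not_less_Least[of k "\<lambda>l. armijo f x w (\<gamma>\<^sub>0 / 3 ^ l)"] by (simp add: l_def)
    then have "c < \<gamma>\<^sub>0 / 3 ^ k"
      using acc[OF _ le, of k] \<open>\<gamma>\<^sub>0 > 0\<close> by force
    then show ?thesis by (simp add: step Suc)
  qed (simp add: step)
qed

lemma convergent_to_isolated_cluster_point: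
  fixes x :: "nat \<Rightarrow> 'a::heine_borel"
  assumes r: "strict_mono r" "(x \<circ> r) \<longlonglongrightarrow> p"
    and "\<rho> > 0"
    and isolated: "\<And>s q. strict_mono s \<Longrightarrow> (x \<circ> s) \<longlonglongrightarrow> q \<Longrightarrow> dist q p \<le> \<rho> \<Longrightarrow> q = p"
    and small: "\<And>\<epsilon>. \<epsilon> > 0 \<Longrightarrow> \<exists>d>0. \<forall>n. dist (x n) p < d \<longrightarrow> dist (x (Suc n)) (x n) < \<epsilon>"
  shows "x \<longlonglongrightarrow> p"
proof (rule tendstoI)
  fix \<epsilon> :: real
  assume "\<epsilon> > 0"
  define \<eta> where "\<eta> = min \<epsilon> \<rho> / 2"
  have \<eta>: "\<eta> > 0" "2 * \<eta> \<le> \<rho>" "2 * \<eta> \<le> \<epsilon>" using \<open>\<epsilon> > 0\<close> \<open>\<rho> > 0\<close> by (auto simp: \<eta>_def)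
  then obtain d0 where d0: "d0 > 0" "\<And>n. dist (x n) p < d0 \<Longrightarrow> dist (x (Suc n)) (x n) < \<eta>"
    using small by blast
  define d where "d = min d0 \<eta>"
  have d: "d > 0" "d \<le> \<eta>" "d \<le> d0" using d0 \<eta> by (auto simp: d_def)
  define S where "S = cball p (2 * \<eta>) - ball p d"
  have "compact S" unfolding S_def by (intro compact_diff) auto
  have "finite {n. x n \<in> S}"
  proof (rule ccontr)
    assume "infinite {n. x n \<in> S}"
    then obtain s :: "nat \<Rightarrow> nat" where s: "strict_mono s" "\<And>n. x (s n) \<in> S"
      using infinite_enumerate by blast
    then have "\<forall>n. (x \<circ> s) n \<in> S" by simp
    then obtain q t where q: "q \<in> S" "strict_mono t" "((x \<circ> s) \<circ> t) \<longlonglongrightarrow> q"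
      by (rule seq_compactE[OF \<open>compact S\<close>[unfolded compact_eq_seq_compact_metric]])
    have "q = p"
    proof (rule isolated)
      show "strict_mono (s \<circ> t)" using s q by (intro strict_mono_o)
      show "(x \<circ> (s \<circ> t)) \<longlonglongrightarrow> q" using q by (simp only: o_assoc)
      show "dist q p \<le> \<rho>" using q \<eta> by (simp add: S_def dist_commute)
    qed
    then show False using q d by (simp add: S_def)
  qed
  then obtain N where N: "\<And>n. n \<ge> N \<Longrightarrow> x n \<notin> S"
    unfolding finite_nat_set_iff_bounded by (auto simp: not_less[symmetric])
  have "\<forall>\<^sub>F n in sequentially. dist ((x \<circ> r) n) p < d"
    using r(2) d(1) by (rule tendstoD)
  then have "\<forall>\<^sub>F n in sequentially. dist ((x \<circ> r) n) p < d \<and> n \<ge> N"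
    using eventually_ge_at_top by (rule eventually_conj)
  then obtain k where "dist (x (r k)) p < d" "k \<ge> N"
    unfolding eventually_sequentially by auto
  then obtain M where M: "M \<ge> N" "dist (x M) p < d"
    using seq_suble[OF r(1), of k] le_trans by blast
  have "dist (x n) p < d" if "M \<le> n" for n
    using that
  proof (induction n rule: dec_induct)
    case (step n)
    have "dist (x (Suc n)) p < 2 * \<eta>"
      using d0(2)[of n] step.IH d dist_triangle[of "x (Suc n)" p "x n"] by linarith
    moreover have "x (Suc n) \<notin> S" using N[of "Suc n"] step M by simp
    ultimately show ?case by (simp add: S_def dist_commute)
  qed (use M in simp)
  then have "dist (x n) p < \<epsilon>" if "M \<le> n" for n
    using that d \<eta> by fastforce
  then show "\<forall>\<^sub>F n in sequentially. dist (x n) p < \<epsilon>"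
    unfolding eventually_sequentially by blast
qed

lemma bounded_bilinear_matrix_vector_mult:
  "bounded_bilinear (\<lambda>(A :: real^'n^'m) v. A *v v)"
  by (subst bilinear_conv_bounded_bilinear[symmetric])
    (auto simp: bilinear_def linear_iff matrix_vector_right_distrib matrix_vector_mult_add_rdistrib
      matrix_vector_mult_scaleR scaleR_matrix_vector_assoc)

section \<open>The iteration\<close>

lemma nqn_kappa_sep:
  fixes \<delta> :: "nat \<Rightarrow> real"
  assumes "i \<le> CARD('n::finite)" "j \<le> CARD('n)" "i \<noteq> j"
  shows "2 * nqn_kappa TYPE('n) \<delta> \<le> \<bar>\<delta> i - \<delta> j\<bar>"
proof -
  have "finite ((\<lambda>(i, j). \<bar>\<delta> i - \<delta> j\<bar>) ` ({..CARD('n)} \<times> {..CARD('n)}))" by simp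
  then have "finite {\<bar>\<delta> i - \<delta> j\<bar> | i j. i \<le> CARD('n) \<and> j \<le> CARD('n) \<and> i \<noteq> j}"
    by (rule rev_finite_subset) auto
  then show ?thesis
    unfolding nqn_kappa_def using assms by (auto intro!: Min_le)
qed

lemma nqn_kappa_pos:
  fixes \<delta> :: "nat \<Rightarrow> real"
  assumes "inj_on \<delta> {0..CARD('n::finite)}"
  shows "nqn_kappa TYPE('n) \<delta> > 0"
proof -
  let ?D = "{\<bar>\<delta> i - \<delta> j\<bar> | i j. i \<le> CARD('n) \<and> j \<le> CARD('n) \<and> i \<noteq> j}"
  have "finite ((\<lambda>(i, j). \<bar>\<delta> i - \<delta> j\<bar>) ` ({..CARD('n)} \<times> {..CARD('n)}))" by simp
  then have "finite ?D"
    by (rule rev_finite_subset) auto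
  moreover have "\<bar>\<delta> 0 - \<delta> 1\<bar> \<in> ?D"
    using zero_less_card_finite[where 'a='n] by (intro CollectI exI[of _ 0] exI[of _ 1]) auto
  moreover have "d > 0" if "d \<in> ?D" for d
    using that assms by (auto simp: inj_on_def)
  ultimately have "Min ?D > 0"
    by (subst Min_gr_iff) auto
  then show ?thesis by (simp add: nqn_kappa_def)
qed

locale nqn =
  fixes f :: "real^'n \<Rightarrow> real"
    and \<delta> :: "nat \<Rightarrow> real"
    and \<tau> \<gamma>\<^sub>0 :: real
    and e :: "real^'n \<Rightarrow> 'n \<Rightarrow> real^'n"
  assumes C_3: "C_k 3 f"
    and morse: "morse f"
    and inj_delta: "inj_on \<delta> {0..CARD('n)}"
    and tau_pos: "\<tau> > 0"
    and gamma0_pos: "0 < \<gamma>\<^sub>0" and gamma0_less_1: "\<gamma>\<^sub>0 < 1"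
    and orthonormal: "\<And>x. orthonormal_basis (e x)"
begin

abbreviation g where "g \<equiv> gradient f"
abbreviation H where "H \<equiv> hessian f"
abbreviation A where "A \<equiv> nqn_matrix f \<delta> \<tau>"
abbreviation w where "w \<equiv> nqn_w f \<delta> \<tau> e"
abbreviation w_hat where "w_hat \<equiv> nqn_w_hat f \<delta> \<tau> e"
abbreviation step where "step x \<equiv> armijo_step f \<gamma>\<^sub>0 x (w_hat x)"
abbreviation next_pt where "next_pt \<equiv> nqn_next f \<delta> \<tau> \<gamma>\<^sub>0 e"

lemma C_2: "C_k 2 f"
  using C_3 C_k_Suc_imp_C_k[of 2 f] by (simp add: eval_nat_numeral)

lemma f_differentiable: "f differentiable (at x)"
  using C_2 by (simp add: eval_nat_numeral)

lemma f_continuous: "isCont f x"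
  using f_differentiable by (rule differentiable_imp_continuous_within)

lemma g_derivative: "(g has_derivative (\<lambda>h. H x *v h)) (at x)"
  using C_2 by (rule has_derivative_hessian)

lemma g_continuous: "isCont g x"
  using g_derivative by (rule has_derivative_continuous)

lemma norm_g_powr_continuous: "isCont (\<lambda>x. norm (g x) powr \<tau>) x"
  unfolding isCont_def
  by (intro tendsto_powr' tendsto_norm isContD[OF g_continuous] tendsto_const) (simp add: tau_pos)

lemma H_continuous: "isCont H x"
  using continuous_on_hessian[OF C_3] by (simp add: continuous_on_eq_continuous_at)

lemma kappa_pos: "nqn_kappa TYPE('n) \<delta> > 0"
  using inj_delta by (rule nqn_kappa_pos)

lemma nqn_index:
  "nqn_index f \<delta> \<tau> x \<le> CARD('n)" "nqn_kappa TYPE('n) \<delta> * norm (g x) powr \<tau> \<le> minsp (A x)"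
proof -
  have "\<exists>j\<le>CARD('n). nqn_kappa TYPE('n) \<delta> * norm (g x) powr \<tau> \<le> minsp (H x + (\<delta> j * norm (g x) powr \<tau>) *\<^sub>R mat 1)"
    using hessian_symmetric[OF C_2] nqn_kappa_sep by (intro minsp_shift_pigeonhole) auto
  then have "\<exists>j. j \<le> CARD('n) \<and> nqn_kappa TYPE('n) \<delta> * norm (g x) powr \<tau> \<le> minsp (nqn_shift f \<delta> \<tau> j x)"
    by (simp add: nqn_shift_def)
  from LeastI_ex[OF this]
  show "nqn_index f \<delta> \<tau> x \<le> CARD('n)" "nqn_kappa TYPE('n) \<delta> * norm (g x) powr \<tau> \<le> minsp (A x)"
    by (simp_all add: nqn_index_def nqn_matrix_def)
qed

lemma minsp_pos: "g x \<noteq> 0 \<Longrightarrow> minsp (A x) > 0"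
  using nqn_index(2)[of x] kappa_pos by (smt (verit) mult_pos_pos norm_eq_zero powr_gt_zero)

text \<open>
  As \<open>j\<close> need not depend continuously on \<open>x\<close>, neither need \<open>A\<close>; a majorant of \<open>A x - H x\<close> that
  depends continuously on \<open>x\<close> replaces continuity.
\<close>
lemma A_minus_H:
  "norm (A x - H x) \<le> (\<Sum>j\<le>CARD('n). \<bar>\<delta> j\<bar>) * norm (g x) powr \<tau> * norm (mat 1 :: real^'n^'n)"
proof -
  define j where "j = nqn_index f \<delta> \<tau> x"
  have "\<bar>\<delta> j\<bar> \<le> (\<Sum>j\<le>CARD('n). \<bar>\<delta> j\<bar>)"
    using nqn_index(1)[of x] by (intro member_le_sum) (auto simp: j_def)
  moreover have "norm (A x - H x) = \<bar>\<delta> j\<bar> * norm (g x) powr \<tau> * norm (mat 1 :: real^'n^'n)"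
    by (simp add: nqn_matrix_def nqn_shift_def j_def abs_mult)
  ultimately show ?thesis
    by (simp add: mult_right_mono)
qed

lemma w_bounds:
  assumes "g x \<noteq> 0" and "\<And>u. norm u = 1 \<Longrightarrow> norm (A x *v u) \<le> B"
  shows "(norm (g x))\<^sup>2 / B \<le> w x \<bullet> g x" "minsp (A x) * (norm (w x))\<^sup>2 \<le> w x \<bullet> g x"
    "norm (w x) \<le> norm (g x) / minsp (A x)"
proof -
  have "norm (e x i) = 1" for i
    using orthonormal by (rule orthonormal_basis_norm)
  then have "minsp (A x) \<le> norm (A x *v e x i)" "norm (A x *v e x i) \<le> B" for i
    using minsp_mult_norm_le[of "A x" "e x i"] assms by simp_all
  note bounds = weighted_direction_bounds[OF orthonormal[of x] minsp_pos[OF assms(1)],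
      where a = "\<lambda>i. norm (A x *v e x i)" and B = B, OF this nqn_w_def[of f \<delta> \<tau> e x]]
  show "(norm (g x))\<^sup>2 / B \<le> w x \<bullet> g x" by (rule bounds(1))
  show "minsp (A x) * (norm (w x))\<^sup>2 \<le> w x \<bullet> g x" by (rule bounds(2))
  show "norm (w x) \<le> norm (g x) / minsp (A x)" by (rule bounds(3))
qed

lemma w_bounds':
  assumes "g x \<noteq> 0"
  shows "minsp (A x) * (norm (w x))\<^sup>2 \<le> w x \<bullet> g x" "norm (w x) \<le> norm (g x) / minsp (A x)"
proof -
  have "norm (A x *v u) \<le> onorm ((*v) (A x))" if "norm u = 1" for u
    using onorm[OF matrix_vector_mul_bounded_linear, of "A x" u] that by simp
  note bounds = w_bounds(2,3)[OF assms this]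
  show "minsp (A x) * (norm (w x))\<^sup>2 \<le> w x \<bullet> g x" by (rule bounds(1))
  show "norm (w x) \<le> norm (g x) / minsp (A x)" by (rule bounds(2))
qed

lemma norm_w_hat: "norm (w_hat x) \<le> 1" "norm (w_hat x) \<le> norm (w x)"
proof -
  have "norm (w_hat x) = norm (w x) / max 1 (norm (w x))"
    by (simp add: nqn_w_hat_def divide_inverse mult.commute)
  moreover have "norm (w x) / max 1 (norm (w x)) \<le> norm (w x)"
    by (simp add: divide_le_eq mult_le_cancel_left1)
  ultimately show "norm (w_hat x) \<le> 1" "norm (w_hat x) \<le> norm (w x)"
    by (simp_all add: divide_le_eq)
qed

lemma w_hat_inner: "w_hat x \<bullet> g x = (w x \<bullet> g x) / max 1 (norm (w x))"
  by (simp add: nqn_w_hat_def divide_inverse mult.commute)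

lemma w_hat_coercive:
  assumes "g x \<noteq> 0"
  shows "minsp (A x) * (norm (w_hat x))\<^sup>2 \<le> w_hat x \<bullet> g x"
proof -
  define c where "c = max 1 (norm (w x))"
  have c: "c \<ge> 1" by (simp add: c_def)
  have "minsp (A x) * (norm (w_hat x))\<^sup>2 = minsp (A x) * (norm (w x))\<^sup>2 / c\<^sup>2"
    using c by (simp add: nqn_w_hat_def c_def[symmetric] power_mult_distrib power_divide divide_inverse
        power_inverse mult.commute)
  also have "\<dots> \<le> minsp (A x) * (norm (w x))\<^sup>2 / c"
    using c self_le_power[of c 2] by (intro divide_left_mono) (auto simp: minsp_nonneg)
  also have "\<dots> \<le> w_hat x \<bullet> g x"
    unfolding w_hat_inner c_def[symmetric]
    using w_bounds'(1)[OF assms] c by (intro divide_right_mono) auto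
  finally show ?thesis .
qed

lemma w_hat_inner_nonneg: "g x \<noteq> 0 \<Longrightarrow> 0 \<le> w_hat x \<bullet> g x"
  using w_hat_coercive[of x] minsp_nonneg[of "A x"] by (smt (verit) mult_nonneg_nonneg zero_le_power2)

lemma A_bounded_on_compact:
  assumes "compact S"
  shows "\<exists>B>0. \<forall>x\<in>S. \<forall>u. norm u = 1 \<longrightarrow> norm (A x *v u) \<le> B"
proof -
  obtain K where K: "K > 0" "\<And>(M :: real^'n^'n) u. norm (M *v u) \<le> norm M * norm u * K"
    using bounded_bilinear.pos_bounded[OF bounded_bilinear_matrix_vector_mult] by blast
  define h where "h x = norm (H x) +
    (\<Sum>j\<le>CARD('n). \<bar>\<delta> j\<bar>) * norm (g x) powr \<tau> * norm (mat 1 :: real^'n^'n)" for x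
  have "isCont h x" for x
    unfolding h_def by (intro continuous_intros norm_g_powr_continuous H_continuous)
  then have "continuous_on S h"
    by (simp add: continuous_at_imp_continuous_on)
  then have "bounded (h ` S)"
    using assms by (intro compact_imp_bounded compact_continuous_image)
  then obtain C where C: "C > 0" "\<And>x. x \<in> S \<Longrightarrow> norm (h x) \<le> C"
    unfolding bounded_pos by blast
  have "norm (A x *v u) \<le> C * K" if "x \<in> S" "norm u = 1" for x u
  proof -
    have "norm (A x) \<le> h x"
      using norm_triangle_sub[of "A x" "H x"] A_minus_H[of x] by (simp add: h_def)
    then have "norm (A x) \<le> C" using C(2)[OF \<open>x \<in> S\<close>] by simp
    then have "norm (A x) * K \<le> C * K" using K by simp
    then show ?thesis using K(2)[of "A x" u] that by simp
  qed
  then show ?thesis using C K by (intro exI[of _ "C * K"]) auto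
qed

lemma g_lipschitz: "\<exists>L>0. \<forall>y\<in>cball 0 R. \<forall>z\<in>cball 0 R. norm (g y - g z) \<le> L * norm (y - z)"
proof -
  obtain K where K: "K > 0" "\<And>(M :: real^'n^'n) u. norm (M *v u) \<le> norm M * norm u * K"
    using bounded_bilinear.pos_bounded[OF bounded_bilinear_matrix_vector_mult] by blast
  have "bounded (H ` cball 0 R)"
    by (intro compact_imp_bounded compact_continuous_image)
      (auto intro: continuous_at_imp_continuous_on H_continuous)
  then obtain C where C: "C > 0" "\<And>x. x \<in> cball 0 R \<Longrightarrow> norm (H x) \<le> C"
    unfolding bounded_pos by blast
  have "onorm ((*v) (H x)) \<le> C * K" if "x \<in> cball 0 R" for x
  proof (rule onorm_le)
    fix u
    have "norm (H x *v u) \<le> norm (H x) * (norm u * K)" using K(2)[of "H x" u] by (simp add: mult.assoc)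
    also have "\<dots> \<le> C * (norm u * K)" using C(2)[OF that] K by (intro mult_right_mono) auto
    finally show "norm (H x *v u) \<le> C * K * norm u" by (simp add: mult_ac)
  qed
  then have "norm (g y - g z) \<le> C * K * norm (y - z)" if "y \<in> cball 0 R" "z \<in> cball 0 R" for y z
    using that has_derivative_at_withinI[OF g_derivative]
    by (intro differentiable_bound[of "cball 0 R"]) auto
  then show ?thesis using C K by (intro exI[of _ "C * K"]) auto
qed

lemma step_accepted:
  assumes "g x \<noteq> 0" "x \<in> cball 0 R" "L > 0"
    and L: "\<And>y z. y \<in> cball 0 (R + 1) \<Longrightarrow> z \<in> cball 0 (R + 1) \<Longrightarrow> norm (g y - g z) \<le> L * norm (y - z)"
  shows "armijo f x (w_hat x) (step x)" "min \<gamma>\<^sub>0 (2 * minsp (A x) / (9 * L)) \<le> step x" "step x \<le> \<gamma>\<^sub>0"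
proof -
  have "armijo f x (w_hat x) \<gamma>" if \<gamma>: "0 < \<gamma>" "\<gamma> \<le> \<gamma>\<^sub>0" "\<gamma> \<le> 2 * minsp (A x) / (3 * L)" for \<gamma>
  proof (rule armijo_if_small[OF f_differentiable])
    have x: "x \<in> cball 0 (R + 1)" using assms(2) by simp
    have "norm (\<gamma> *\<^sub>R w_hat x) \<le> 1 * 1"
      using \<gamma> gamma0_less_1 norm_w_hat(1)[of x] unfolding norm_scaleR by (intro mult_mono) auto
    then have "x - \<gamma> *\<^sub>R w_hat x \<in> cball 0 (R + 1)"
      using assms(2) norm_triangle_ineq4[of x "\<gamma> *\<^sub>R w_hat x"] by simp
    then have "closed_segment x (x - \<gamma> *\<^sub>R w_hat x) \<subseteq> cball 0 (R + 1)"
      using x by (intro closed_segment_subset) auto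
    then show "norm (g y - g x) \<le> L * norm (y - x)" if "y \<in> closed_segment x (x - \<gamma> *\<^sub>R w_hat x)" for y
      using that L x by blast
    show "minsp (A x) * (norm (w_hat x))\<^sup>2 \<le> w_hat x \<bullet> g x"
      using assms(1) by (rule w_hat_coercive)
    show "L * \<gamma> \<le> 2 / 3 * minsp (A x)"
      using \<gamma>(3) \<open>L > 0\<close> by (simp add: field_simps)
  qed (use \<gamma> \<open>L > 0\<close> in auto)
  note acc = this
  have pos: "2 * minsp (A x) / (3 * L) > 0"
    using minsp_pos[OF assms(1)] \<open>L > 0\<close> by simp
  note bounds = armijo_step_bounds[OF gamma0_pos pos acc]
  show "armijo f x (w_hat x) (step x)" by (rule bounds(1))
  show "min \<gamma>\<^sub>0 (2 * minsp (A x) / (9 * L)) \<le> step x" using bounds(2) by simp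
  show "step x \<le> \<gamma>\<^sub>0" by (rule bounds(3))
qed

lemma next_pt: "g x \<noteq> 0 \<Longrightarrow> next_pt x = x - step x *\<^sub>R w_hat x"
  by (simp add: nqn_next_def Let_def)

lemma step_basic:
  assumes "g x \<noteq> 0"
  shows "armijo f x (w_hat x) (step x)" "0 < step x" "step x \<le> 1"
proof -
  obtain L where L: "L > 0"
    "\<And>y z. y \<in> cball 0 (norm x + 1) \<Longrightarrow> z \<in> cball 0 (norm x + 1) \<Longrightarrow> norm (g y - g z) \<le> L * norm (y - z)"
    using g_lipschitz[of "norm x + 1"] by blast
  have x: "x \<in> cball 0 (norm x)" by simp
  show "armijo f x (w_hat x) (step x)"
    by (rule step_accepted(1)[OF assms x L])
  have "0 < min \<gamma>\<^sub>0 (2 * minsp (A x) / (9 * L))"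
    using gamma0_pos minsp_pos[OF assms] L(1) by simp
  also have "\<dots> \<le> step x"
    by (rule step_accepted(2)[OF assms x L])
  finally show "0 < step x" .
  show "step x \<le> 1"
    using step_accepted(3)[OF assms x L] gamma0_less_1 by simp
qed

lemma next_pt_decrease:
  assumes "g x \<noteq> 0"
  shows "f (next_pt x) \<le> f x - step x * (w_hat x \<bullet> g x) / 3"
  using step_basic(1)[OF assms] by (simp add: next_pt[OF assms] armijo_def)

lemma f_next_le: "f (next_pt x) \<le> f x"
proof (cases "g x = 0")
  case False
  then have "0 \<le> step x * (w_hat x \<bullet> g x)"
    using step_basic(2) w_hat_inner_nonneg by (simp add: less_imp_le)
  then show ?thesis using next_pt_decrease[OF False] by simp
qed (simp add: nqn_next_def)

lemma uniform_decrease: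
  assumes "g q \<noteq> 0"
  shows "\<exists>d>0. \<exists>\<epsilon>>0. \<forall>x. dist x q < d \<longrightarrow> f (next_pt x) \<le> f x - \<epsilon>"
proof -
  define c where "c = norm (g q) / 2"
  have c: "c > 0" using assms by (simp add: c_def)
  obtain d0 where d0: "d0 > 0" "\<And>x. dist x q < d0 \<Longrightarrow> dist (g x) (g q) < c"
    using g_continuous[of q] c unfolding continuous_at_eps_delta by blast
  define R where "R = norm q + d0"
  obtain L where L: "L > 0"
    "\<And>y z. y \<in> cball 0 (R + 1) \<Longrightarrow> z \<in> cball 0 (R + 1) \<Longrightarrow> norm (g y - g z) \<le> L * norm (y - z)"
    using g_lipschitz[of "R + 1"] by blast
  obtain B where B: "B > 0" "\<And>x u. x \<in> cball 0 R \<Longrightarrow> norm u = 1 \<Longrightarrow> norm (A x *v u) \<le> B"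
    using A_bounded_on_compact[of "cball 0 R"] by auto
  define \<mu> where "\<mu> = nqn_kappa TYPE('n) \<delta> * c powr \<tau>"
  have \<mu>: "\<mu> > 0" using kappa_pos c by (simp add: \<mu>_def)
  define \<gamma> where "\<gamma> = min \<gamma>\<^sub>0 (2 * \<mu> / (9 * L))"
  have \<gamma>: "\<gamma> > 0" using gamma0_pos \<mu> L(1) by (simp add: \<gamma>_def)
  define M where "M = max 1 (3 * c / \<mu>)"
  have M: "M \<ge> 1" by (simp add: M_def)
  define \<epsilon> where "\<epsilon> = \<gamma> * (c\<^sup>2 / B / M) / 3"
  have "\<epsilon> > 0" using \<gamma> c B(1) M by (simp add: \<epsilon>_def)
  have "f (next_pt x) \<le> f x - \<epsilon>" if x: "dist x q < d0" for x
  proof -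
    have "dist (g x) (g q) < c" using d0(2)[OF x] .
    then have ge: "c \<le> norm (g x)" and le: "norm (g x) \<le> 3 * c"
      unfolding c_def dist_norm
      using norm_triangle_ineq2[of "g x" "g q"] norm_triangle_ineq2[of "g q" "g x"] norm_minus_commute[of "g x" "g q"] by linarith+
    then have "g x \<noteq> 0" using c by auto
    have xR: "x \<in> cball 0 R"
      using x norm_triangle_sub[of x q] by (simp add: R_def dist_norm)
    have "\<mu> \<le> nqn_kappa TYPE('n) \<delta> * norm (g x) powr \<tau>"
      unfolding \<mu>_def using kappa_pos ge c tau_pos by (intro mult_left_mono powr_mono2) auto
    then have minsp: "\<mu> \<le> minsp (A x)" using nqn_index(2)[of x] by linarith
    have "\<gamma> \<le> min \<gamma>\<^sub>0 (2 * minsp (A x) / (9 * L))"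
      unfolding \<gamma>_def using minsp L(1) by (intro min.mono divide_right_mono mult_left_mono) auto
    then have \<gamma>_le: "\<gamma> \<le> step x"
      by (rule order_trans[OF _ step_accepted(2)[OF \<open>g x \<noteq> 0\<close> xR L]])
    have "norm (w x) \<le> norm (g x) / minsp (A x)"
      using \<open>g x \<noteq> 0\<close> by (rule w_bounds'(2))
    also have "\<dots> \<le> 3 * c / \<mu>"
      using le minsp \<mu> c by (intro frac_le) auto
    finally have "max 1 (norm (w x)) \<le> M" by (simp add: M_def)
    moreover have wg: "c\<^sup>2 / B \<le> w x \<bullet> g x"
    proof -
      have "c\<^sup>2 / B \<le> (norm (g x))\<^sup>2 / B"
        using ge c B(1) by (intro divide_right_mono power_mono) auto
      also have "\<dots> \<le> w x \<bullet> g x"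
        by (rule w_bounds(1)[OF \<open>g x \<noteq> 0\<close> B(2)[OF xR]])
      finally show ?thesis .
    qed
    moreover have "0 \<le> c\<^sup>2 / B" using B(1) by simp
    then have "0 \<le> w x \<bullet> g x" using wg by (rule order_trans)
    ultimately have "c\<^sup>2 / B / M \<le> w_hat x \<bullet> g x"
      unfolding w_hat_inner using B(1) by (intro frac_le) auto
    then have "\<gamma> * (c\<^sup>2 / B / M) \<le> step x * (w_hat x \<bullet> g x)"
      using \<gamma> \<gamma>_le B(1) M by (intro mult_mono) auto
    then show ?thesis
      using next_pt_decrease[OF \<open>g x \<noteq> 0\<close>] by (simp add: \<epsilon>_def)
  qed
  then show ?thesis
    using d0(1) \<open>\<epsilon> > 0\<close> by (intro exI[of _ d0] exI[of _ \<epsilon>] conjI) auto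
qed

lemma hessian_bounded_below:
  assumes "g p = 0"
  shows "\<exists>c>0. \<forall>u. c * norm u \<le> norm (H p *v u)"
proof -
  have "inj ((*v) (H p))"
    using assms morse by (simp add: morse_def inj_matrix_vector_mult)
  then obtain c where "c > 0" "\<And>u. c * norm u \<le> norm (H p *v u)"
    using linear_inj_bounded_below_pos[OF matrix_vector_mul_linear] by blast
  then show ?thesis by blast
qed

lemma critical_point_isolated:
  assumes "g p = 0"
  shows "\<exists>\<rho>>0. \<forall>y. dist y p \<le> \<rho> \<longrightarrow> g y = 0 \<longrightarrow> y = p"
proof -
  obtain c where c: "c > 0" "\<And>u. c * norm u \<le> norm (H p *v u)"
    using hessian_bounded_below[OF assms] by blast
  have "c / 2 > 0" using c by simp
  then obtain d where d: "d > 0" "\<And>y. norm (y - p) < d \<Longrightarrow> norm (g y - g p - H p *v (y - p)) \<le> c / 2 * norm (y - p)"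
    using g_derivative[of p] unfolding has_derivative_at_alt by blast
  have "y = p" if "dist y p \<le> d / 2" "g y = 0" for y
  proof -
    have "c * norm (y - p) \<le> c / 2 * norm (y - p)"
      using d(2)[of y] c(2)[of "y - p"] that assms d(1) by (simp add: dist_norm)
    then show ?thesis using c(1) by simp
  qed
  then show ?thesis using d(1) by (intro exI[of _ "d / 2"]) auto
qed

text \<open>Near a nondegenerate critical point, \<open>minsp (A x)\<close> is bounded away from \<open>0\<close>, so that \<open>w x\<close> tends to \<open>0\<close>.\<close>
lemma small_steps:
  assumes p: "g p = 0" and "\<epsilon> > 0"
  shows "\<exists>d>0. \<forall>x. dist x p < d \<longrightarrow> dist (next_pt x) x < \<epsilon>"
proof -
  obtain c where c: "c > 0" "\<And>u. c * norm u \<le> norm (H p *v u)"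
    using hessian_bounded_below[OF p] by blast
  obtain K where K: "K > 0" "\<And>(M :: real^'n^'n) u. norm (M *v u) \<le> norm M * norm u * K"
    using bounded_bilinear.pos_bounded[OF bounded_bilinear_matrix_vector_mult] by blast
  define h where "h x = (norm (H x - H p) +
    (\<Sum>j\<le>CARD('n). \<bar>\<delta> j\<bar>) * norm (g x) powr \<tau> * norm (mat 1 :: real^'n^'n)) * K" for x
  have "isCont h p"
    unfolding h_def by (intro continuous_intros norm_g_powr_continuous H_continuous)
  moreover have "h p = 0" using p tau_pos by (simp add: h_def)
  ultimately obtain d1 where d1: "d1 > 0" "\<And>x. dist x p < d1 \<Longrightarrow> \<bar>h x\<bar> < c / 2"
    using c unfolding continuous_at_eps_delta dist_real_def by (metis diff_zero half_gt_zero)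
  obtain d2 where d2: "d2 > 0" "\<And>x. dist x p < d2 \<Longrightarrow> norm (g x) < \<epsilon> * (c / 2)"
    using g_continuous[of p] c \<open>\<epsilon> > 0\<close> p unfolding continuous_at_eps_delta dist_norm
    by (metis diff_zero half_gt_zero mult_pos_pos)
  have "dist (next_pt x) x < \<epsilon>" if x: "dist x p < min d1 d2" for x
  proof (cases "g x = 0")
    case False
    have "c / 2 \<le> minsp (A x)"
    proof (rule minsp_ge)
      fix u :: "real^'n" assume u: "norm u = 1"
      have "norm (A x - H p) \<le> norm (H x - H p) + norm (A x - H x)"
        using norm_triangle_ineq[of "H x - H p" "A x - H x"] by simp
      also have "\<dots> \<le> norm (H x - H p) +
          (\<Sum>j\<le>CARD('n). \<bar>\<delta> j\<bar>) * norm (g x) powr \<tau> * norm (mat 1 :: real^'n^'n)"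
        using A_minus_H by simp
      finally have "norm (A x - H p) * K \<le> h x"
        unfolding h_def using K(1) by (intro mult_right_mono) auto
      moreover have "norm ((A x - H p) *v u) \<le> norm (A x - H p) * K"
        using K(2)[of "A x - H p" u] u by simp
      moreover have "h x < c / 2" using d1(2)[of x] x by simp
      moreover have "norm (H p *v u) - norm ((A x - H p) *v u) \<le> norm (A x *v u)"
        using norm_triangle_ineq2[of "H p *v u" "A x *v u"]
        by (simp add: matrix_vector_mult_diff_rdistrib norm_minus_commute)
      ultimately show "c / 2 \<le> norm (A x *v u)"
        using c(2)[of u] u by simp
    qed
    have "dist (next_pt x) x = step x * norm (w_hat x)"
      using step_basic(2)[OF False] by (simp add: next_pt[OF False] dist_norm)
    also have "\<dots> \<le> norm (w_hat x)"
      using step_basic(2,3)[OF False] by (simp add: mult_left_le_one_le)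
    also have "\<dots> \<le> norm (g x) / minsp (A x)"
      using norm_w_hat(2)[of x] w_bounds'(2)[OF False] by simp
    also have "\<dots> \<le> norm (g x) / (c / 2)"
      using c \<open>c / 2 \<le> minsp (A x)\<close> by (intro divide_left_mono) auto
    also have "\<dots> < \<epsilon>"
      using d2(2)[of x] x c by (simp add: divide_less_eq)
    finally show ?thesis .
  qed (simp add: nqn_next_def \<open>\<epsilon> > 0\<close>)
  then show ?thesis using d1 d2 by (intro exI[of _ "min d1 d2"]) auto
qed

context
  fixes x\<^sub>0 :: "real^'n"
begin

abbreviation X where "X \<equiv> nqn_seq f \<delta> \<tau> \<gamma>\<^sub>0 e x\<^sub>0"

lemma f_antimono: "m \<le> n \<Longrightarrow> f (X n) \<le> f (X m)"
proof (induction n rule: dec_induct)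
  case (step n)
  then show ?case using f_next_le[of "X n"] by simp
qed simp

lemma cluster_point_critical:
  assumes r: "strict_mono r" "(X \<circ> r) \<longlonglongrightarrow> q"
  shows "g q = 0"
proof (rule ccontr)
  assume "g q \<noteq> 0"
  then obtain d \<epsilon> where d: "d > 0" "\<epsilon> > 0" "\<And>x. dist x q < d \<Longrightarrow> f (next_pt x) \<le> f x - \<epsilon>"
    using uniform_decrease by blast
  have lim: "(\<lambda>n. f (X (r n))) \<longlonglongrightarrow> f q"
    using isCont_tendsto_compose[OF f_continuous r(2)] by simp
  have ge: "f q \<le> f (X n)" for n
    using seq_suble[OF r(1)] f_antimono
    by (intro LIMSEQ_le_const2[OF lim] exI[of _ n]) (meson order_trans)
  have "\<forall>\<^sub>F n in sequentially. dist ((X \<circ> r) n) q < d \<and> f (X (r n)) < f q + \<epsilon>"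
    using tendstoD[OF r(2) d(1)] order_tendstoD(2)[OF lim, of "f q + \<epsilon>"] d(2)
    by (intro eventually_conj) auto
  then obtain n where "dist (X (r n)) q < d" "f (X (r n)) < f q + \<epsilon>"
    by (auto simp: eventually_sequentially)
  then have "f (X (Suc (r n))) < f q"
    using d(3)[of "X (r n)"] by simp
  then show False using ge[of "Suc (r n)"] by simp
qed

lemma diverges_or_converges:
  "filterlim (\<lambda>n. norm (X n)) at_top sequentially \<or> (\<exists>p. g p = 0 \<and> X \<longlonglongrightarrow> p)"
proof (unfold disj_imp, rule impI)
  assume "\<not> filterlim (\<lambda>n. norm (X n)) at_top sequentially"
  then obtain R where "\<not> (\<forall>\<^sub>F n in sequentially. R \<le> norm (X n))"
    unfolding filterlim_at_top by blast
  then have "infinite {n. norm (X n) < R}"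
    by (simp add: not_eventually not_le frequently_cofinite flip: cofinite_eq_sequentially)
  then obtain s :: "nat \<Rightarrow> nat" where s: "strict_mono s" "\<And>n. norm (X (s n)) < R"
    using infinite_enumerate by blast
  then have "\<forall>n. (X \<circ> s) n \<in> cball 0 R" by (simp add: less_imp_le)
  then obtain p t where t: "strict_mono t" "((X \<circ> s) \<circ> t) \<longlonglongrightarrow> p"
    by (rule seq_compactE[OF compact_cball[unfolded compact_eq_seq_compact_metric]])
  then have st: "strict_mono (s \<circ> t)" "(X \<circ> (s \<circ> t)) \<longlonglongrightarrow> p"
    using s(1) by (simp_all only: strict_mono_o o_assoc)
  then have p: "g p = 0" by (rule cluster_point_critical)
  obtain \<rho> where \<rho>: "\<rho> > 0" "\<And>y. dist y p \<le> \<rho> \<Longrightarrow> g y = 0 \<Longrightarrow> y = p"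
    using critical_point_isolated[OF p] by blast
  have "X \<longlonglongrightarrow> p"
  proof (rule convergent_to_isolated_cluster_point[OF st \<rho>(1)])
    show "q = p" if "strict_mono s" "(X \<circ> s) \<longlonglongrightarrow> q" "dist q p \<le> \<rho>" for s q
      using \<rho>(2)[OF that(3) cluster_point_critical[OF that(1,2)]] .
    show "\<exists>d>0. \<forall>n. dist (X n) p < d \<longrightarrow> dist (X (Suc n)) (X n) < \<epsilon>" if "\<epsilon> > 0" for \<epsilon>
      using small_steps[OF p that] by auto
  qed
  with p show "\<exists>p. g p = 0 \<and> X \<longlonglongrightarrow> p" by blast
qed

lemma compact_sublevels_imp_not_diverges:
  assumes "compact_sublevels f"
  shows "\<not> filterlim (\<lambda>n. norm (X n)) at_top sequentially"
proof
  assume diverges: "filterlim (\<lambda>n. norm (X n)) at_top sequentially"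
  have "bounded {x. f x \<le> f x\<^sub>0}"
    using assms by (simp add: compact_sublevels_def compact_imp_bounded)
  then obtain C where "\<And>x. f x \<le> f x\<^sub>0 \<Longrightarrow> norm x \<le> C"
    unfolding bounded_iff by blast
  then have "norm (X n) \<le> C" for n
    using f_antimono[of 0 n] by simp
  moreover have "\<forall>\<^sub>F n in sequentially. C < norm (X n)"
    using diverges by (simp add: filterlim_at_top_dense)
  ultimately show False
    by (auto simp: eventually_sequentially not_le[symmetric])
qed

end

end

theorem theorem1p2:
  fixes f :: "real^'n \<Rightarrow> real"
    and \<delta> :: "nat \<Rightarrow> real"
    and \<tau> \<gamma>\<^sub>0 :: real
    and e :: "real^'n \<Rightarrow> 'n \<Rightarrow> real^'n"
  assumes "C_k 3 f"
    and "morse f"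
    and "inj_on \<delta> {0..CARD('n)}"
    and "\<tau> > 0"
    and "0 < \<gamma>\<^sub>0" and "\<gamma>\<^sub>0 < 1"
    and "\<And>x. orthonormal_basis (e x)"
  shows "\<exists>E \<in> null_sets lebesgue. \<forall>x\<^sub>0. x\<^sub>0 \<notin> E \<longrightarrow>
    (let x = nqn_seq f \<delta> \<tau> \<gamma>\<^sub>0 e x\<^sub>0;
         diverges = filterlim (\<lambda>n. norm (x n)) at_top sequentially;
         converges = (\<exists>p. gradient f p = 0 \<and> x \<longlonglongrightarrow> p)
     in (diverges \<or> converges) \<and>
        (compact_sublevels f \<longrightarrow> converges \<and> \<not> diverges))"
proof -
  interpret nqn f \<delta> \<tau> \<gamma>\<^sub>0 e
    using assms by unfold_locales auto
  have "{} \<in> null_sets lebesgue" by simp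
  then show ?thesis
    unfolding Let_def using diverges_or_converges compact_sublevels_imp_not_diverges by blast
qed

end
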